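(* Let $X_1,X_2,\dots$ be independent standard Cauchy random variables (location $0$, scale $1$). For every integer $n\ge1$, the $n$th level continued fraction $$[X_1;X_2,\dots,X_n]=X_1+\cfrac{1}{X_2+\cfrac{1}{\ddots+X_{n-1}+\cfrac1{X_n}}}$$ has Cauchy distribution with location parameter $0$ and scale parameter $b_n=F_{n+1}/F_n$, where $F_n$ are the Fibonacci numbers.
   Context: $F_1=F_2=1$, $F_{n+1}=F_n+F_{n-1}$. The Cauchy law $C(a,b)$ with location $a$ and scale $b>0$ has density $\frac1\pi\frac{b}{(x-a)^2+b^2}$. $[X_1]=X_1$, and $[X_1;X_2,\dots,X_n]=X_1+1/[X_2;X_3,\dots,X_n]$ (almost surely well defined). *)

theory Defs
  imports "HOL-Probability.Probability" "HOL-Number_Theory.Fib"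
begin

definition cauchy_density :: "real \<Rightarrow> real \<Rightarrow> real \<Rightarrow> real" where
  "cauchy_density a b x = 1 / pi * (b / ((x - a)\<^sup>2 + b\<^sup>2))"

text \<open>
  Finite continued fractions exist only for nonempty lists of entries; the value on the empty
  list is left unspecified. A vanishing denominator is not excluded here but yields a junk
  value through \<open>1 / 0 = 0\<close>; the predicate \<open>cont_frac_defined\<close> says that no denominator
  vanishes.
\<close>

fun cont_frac :: "real list \<Rightarrow> real" where
  "cont_frac [x] = x"
| "cont_frac (x # y # ys) = x + 1 / cont_frac (y # ys)"

fun cont_frac_defined :: "real list \<Rightarrow> bool" where
  "cont_frac_defined [] \<longleftrightarrow> False"
| "cont_frac_defined [x] \<longleftrightarrow> True"
| "cont_frac_defined (x # y # ys) \<longleftrightarrow>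
     cont_frac_defined (y # ys) \<and> cont_frac (y # ys) \<noteq> 0"

end

theory Submission
  imports Defs "HOL-Real_Asymp.Real_Asymp"
begin

text \<open>
  The reciprocal of a Cauchy variable of scale \<open>b\<close> is Cauchy of scale \<open>1 / b\<close>, and
  scales add up under independent sums. As \<open>[X\<^sub>m; X\<^sub>m\<^sub>+\<^sub>1, \<dots>] = X\<^sub>m + 1 / [X\<^sub>m\<^sub>+\<^sub>1; \<dots>]\<close> has
  independent summands, the scales satisfy \<open>b\<^sub>1 = 1\<close> and \<open>b\<^sub>k\<^sub>+\<^sub>1 = 1 + 1 / b\<^sub>k\<close>, which is the
  recursion of the Fibonacci quotients. The induction adds entries at the front, so it
  runs over all starting indices \<open>m\<close> at once. Denominators vanish with probability \<open>0\<close>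
  because they have a density.
\<close>

section \<open>Convolution of centred Cauchy densities\<close>

lemma cauchy_density_nonneg: "b \<ge> 0 \<Longrightarrow> 0 \<le> cauchy_density a b x"
  by (simp add: cauchy_density_def)

lemma borel_measurable_cauchy_density [measurable]: "cauchy_density a b \<in> borel_measurable borel"
  unfolding cauchy_density_def by measurable

text \<open>Partial fractions in \<open>y\<close> give an explicit antiderivative \<open>G\<close>
  of the integrand, made of one logarithm and two arctangents. Its limits at both ends of the line
  give the integral.\<close>

lemma nn_integral_cauchy_product:
  fixes a b x :: real
  assumes a: "a > 0" and b: "b > 0" and x: "x \<noteq> 0"
  shows "(\<integral>\<^sup>+y. ennreal (cauchy_density 0 a (x - y)) * ennreal (cauchy_density 0 b y) \<partial>lborel)
    = ennreal (cauchy_density 0 (a + b) x)"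
proof -
  \<comment> \<open>\<open>D\<close> is the resultant in \<open>y\<close> of the quadratics \<open>P\<close> and \<open>Q\<close>; it vanishes for \<open>x = 0\<close>,
    \<open>a = b\<close>, whence the hypothesis \<open>x \<noteq> 0\<close>.\<close>
  define D where "D = 4 * x\<^sup>2 * b\<^sup>2 + (x\<^sup>2 + a\<^sup>2 - b\<^sup>2)\<^sup>2"
  \<comment> \<open>Coefficients of the partial fraction decomposition of
    \<open>1 / (P y * Q y)\<close>. The leading coefficients \<open>p\<close> and \<open>- p\<close>
    are opposite, so the two logarithms merge into \<open>ln (P y / Q y)\<close>, which stays
    bounded at infinity.\<close>
  define p where "p = - 2 * x / D"
  define q where "q = (x\<^sup>2 + b\<^sup>2 - a\<^sup>2) / D"
  define r where "r = (x\<^sup>2 + a\<^sup>2 - b\<^sup>2) / D"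
  define P where "P = (\<lambda>y. (y - x)\<^sup>2 + a\<^sup>2)"
  define Q where "Q = (\<lambda>y. y\<^sup>2 + b\<^sup>2)"
  define G where "G = (\<lambda>y. a * b / pi\<^sup>2 *
    (p / 2 * (ln (P y / Q y)) + q / a * arctan ((y - x) / a) + r / b * arctan (y / b)))"
  define f where "f = (\<lambda>y. cauchy_density 0 a (x - y) * cauchy_density 0 b y)"
  have D: "D > 0"
    using x b by (auto simp: D_def intro!: add_pos_nonneg)
  \<comment> \<open>The factor \<open>x\<^sup>2 + (a - b)\<^sup>2\<close> also occurs in the
    numerator of \<open>2 * L\<close>; cancelling it leaves the Cauchy denominator of scale
    \<open>a + b\<close>.\<close>
  have D_fac: "D = (x\<^sup>2 + (a - b)\<^sup>2) * (x\<^sup>2 + (a + b)\<^sup>2)"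
    by (simp add: D_def power2_eq_square algebra_simps)
  have P: "P y > 0" and Q: "Q y > 0" for y
    using a b by (auto simp: P_def Q_def intro!: add_nonneg_pos)
  have partial_fractions:
    "1 / (P y * Q y) = (p * (y - x) + q) / P y + (r - p * y) / Q y" for y
  proof -
    \<comment> \<open>Multiplication by \<open>D\<close> clears the denominators of
      \<open>p\<close>, \<open>q\<close>, \<open>r\<close> and leaves a polynomial identity.\<close>
    have "D = (D * p * (y - x) + D * q) * Q y + (D * r - D * p * y) * P y"
      using D by (simp add: p_def q_def r_def) (simp add: D_def P_def Q_def power2_eq_square algebra_simps)
    also have "\<dots> = D * ((p * (y - x) + q) * Q y + (r - p * y) * P y)"
      by (simp add: algebra_simps)
    finally have "(p * (y - x) + q) * Q y + (r - p * y) * P y = 1"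
      using D by simp
    then show ?thesis
      using P[of y] Q[of y] by (simp add: add_frac_eq)
  qed
  have f_eq: "f y = a * b / pi\<^sup>2 * (1 / (P y * Q y))" for y
    by (simp add: f_def cauchy_density_def P_def Q_def power2_commute[of x y] power2_eq_square[of pi])
  have arctan_deriv: "((\<lambda>y. arctan ((y - c) / d)) has_real_derivative d / ((y - c)\<^sup>2 + d\<^sup>2)) (at y)"
    if "d > 0" for c d y :: real
  proof -
    have "(y - c)\<^sup>2 + d\<^sup>2 > 0"
      using that by (simp add: add_nonneg_pos)
    then show ?thesis
      using that by (auto intro!: derivative_eq_intros simp: divide_simps power2_eq_square)
  qed
  have deriv: "(G has_real_derivative f y) (at y)" for y
  proof -
    have "((\<lambda>y. ln (P y) - ln (Q y)) has_real_derivative 2 * (y - x) / P y - 2 * y / Q y) (at y)"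
      using P[of y] Q[of y] unfolding P_def Q_def
      by (auto intro!: derivative_eq_intros)
    then have "((\<lambda>y. ln (P y / Q y)) has_real_derivative 2 * (y - x) / P y - 2 * y / Q y) (at y)"
      using P Q by (simp add: ln_div less_imp_neq[symmetric])
    then have "(G has_real_derivative a * b / pi\<^sup>2 * (p / 2 * (2 * (y - x) / P y - 2 * y / Q y)
        + q / a * (a / P y) + r / b * (b / Q y))) (at y)"
      using arctan_deriv[OF a, of x y] arctan_deriv[OF b, of 0 y] unfolding G_def
      by (intro DERIV_cmult DERIV_add) (simp_all add: P_def Q_def)
    also have "a * b / pi\<^sup>2 * (p / 2 * (2 * (y - x) / P y - 2 * y / Q y)
        + q / a * (a / P y) + r / b * (b / Q y)) = f y"
      unfolding f_eq partial_fractions using a b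
      by (simp add: field_simps add_divide_distrib diff_divide_distrib)
    finally show ?thesis .
  qed
  \<comment> \<open>The logarithm tends to 0 at both ends and the arctangents to plus or minus
    \<open>pi / 2\<close>, so the limits of \<open>G\<close> are \<open>L\<close> and
    \<open>- L\<close>.\<close>
  define L where "L = a * b / pi\<^sup>2 * (q / a * (pi / 2) + r / b * (pi / 2))"
  have ln_top: "((\<lambda>y. ln (P y / Q y)) \<longlongrightarrow> 0) at_top" 
    using a b unfolding P_def Q_def by real_asymp
  have ln_bot: "((\<lambda>y. ln (P y / Q y)) \<longlongrightarrow> 0) at_bot" 
    using a b unfolding P_def Q_def by real_asymp
  have arctan_top: "((\<lambda>y. arctan ((y - c) / d)) \<longlongrightarrow> pi / 2) at_top" 
    and arctan_bot: "((\<lambda>y. arctan ((y - c) / d)) \<longlongrightarrow> - (pi / 2)) at_bot" 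
    if "d > 0" for c d :: real
    using that by real_asymp+
  have G_top: "(G \<longlongrightarrow> L) at_top"
  proof -
    have "(G \<longlongrightarrow> a * b / pi\<^sup>2 * (p / 2 * 0 + q / a * (pi / 2) + r / b * (pi / 2))) at_top"
      unfolding G_def using arctan_top[OF a, of x] arctan_top[OF b, of 0]
      by (intro tendsto_mult_left tendsto_add ln_top) simp_all
    then show ?thesis by (simp add: L_def)
  qed
  have G_bot: "(G \<longlongrightarrow> - L) at_bot"
  proof -
    have "(G \<longlongrightarrow> a * b / pi\<^sup>2 * (p / 2 * 0 + q / a * (- (pi / 2)) + r / b * (- (pi / 2)))) at_bot"
      unfolding G_def using arctan_bot[OF a, of x] arctan_bot[OF b, of 0]
      by (intro tendsto_mult_left tendsto_add ln_bot) simp_all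
    then show ?thesis by (simp add: L_def algebra_simps)
  qed
  have f_nonneg: "f y \<ge> 0" for y
    using a b by (simp add: f_def cauchy_density_nonneg)
  have cont: "isCont f y" for y
  proof -
    have "P y * Q y \<noteq> 0" using P[of y] Q[of y] by simp
    then show ?thesis
      unfolding f_eq[abs_def] P_def Q_def by (intro continuous_intros) auto
  qed
  \<comment> \<open>Since \<open>f\<close> is nonnegative, finite limits of \<open>G\<close> yield
    integrability along with the value.\<close>
  have int: "set_integrable lborel (einterval (-\<infinity>) \<infinity>) f"
    "(LBINT y=-\<infinity>..\<infinity>. f y) = L - (- L)"
    by (rule interval_integral_FTC_nonneg[where F = G];
        use deriv cont f_nonneg G_top G_bot in \<open>auto simp: ereal_tendsto_simps\<close>)+
  have "2 * L = cauchy_density 0 (a + b) x"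
  proof -
    have pos: "x\<^sup>2 + (a - b)\<^sup>2 > 0" "x\<^sup>2 + (a + b)\<^sup>2 > 0"
      using x by (auto intro!: add_pos_nonneg)
    have "2 * L = (b * (D * q) + a * (D * r)) / (pi * D)"
      using a b D by (simp add: L_def field_simps power2_eq_square)
    also have "b * (D * q) + a * (D * r) = (a + b) * (x\<^sup>2 + (a - b)\<^sup>2)"
      using D by (simp add: q_def r_def) (simp add: algebra_simps power2_eq_square)
    also have "\<dots> / (pi * D) = cauchy_density 0 (a + b) x"
      using pos x by (simp add: D_fac cauchy_density_def)
    finally show ?thesis .
  qed
  then have "(\<integral>\<^sup>+y. ennreal (f y) \<partial>lborel) = ennreal (cauchy_density 0 (a + b) x)"
    using int f_nonneg
    by (subst nn_integral_eq_integral)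
       (auto simp: set_integrable_def einterval_eq_UNIV interval_lebesgue_integral_def
         set_lebesgue_integral_def)
  then show ?thesis
    using a b by (simp add: f_def ennreal_mult cauchy_density_nonneg)
qed

text \<open>The sum has the convolution as its density. Knowing it off the null set
  \<open>{0}\<close> suffices, because a density matters only almost everywhere.\<close>

lemma (in prob_space) distributed_cauchy_add:
  assumes "a > 0" "b > 0"
    and "indep_var borel X borel Y"
    and "distributed M lborel X (cauchy_density 0 a)"
    and "distributed M lborel Y (cauchy_density 0 b)"
  shows "distributed M lborel (\<lambda>\<omega>. X \<omega> + Y \<omega>) (cauchy_density 0 (a + b))"
proof -
  have "AE x in lborel. (\<integral>\<^sup>+y. ennreal (cauchy_density 0 a (x - y)) *
      ennreal (cauchy_density 0 b y) \<partial>lborel) = ennreal (cauchy_density 0 (a + b) x)"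
    using AE_lborel_singleton[of 0] by eventually_elim (rule nn_integral_cauchy_product[OF assms(1,2)])
  with distributed_convolution[OF assms(3-5)] show ?thesis
    by (subst (asm) distributed_cong_density) auto
qed

section \<open>Reciprocals of Cauchy variables\<close>

text \<open>Substitution along the involution \<open>1 / x\<close> of the nonzero reals, whose
  Jacobian is \<open>1 / x\<^sup>2\<close>. The change of variables is done with absolutely
  integrable functions and then carried back to nonnegative integrals.\<close>

lemma nn_integral_lborel_inverse:
  fixes f :: "real \<Rightarrow> real"
  assumes int: "integrable lborel f" and nonneg: "\<And>x. f x \<ge> 0"
  shows "(\<integral>\<^sup>+x. ennreal (f x) \<partial>lborel) = (\<integral>\<^sup>+x. ennreal (f (1 / x) / x\<^sup>2) \<partial>lborel)"
proof -
  let ?S = "- {0::real}"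
  let ?g = "\<lambda>x. \<bar>- (1 / x\<^sup>2)\<bar> * f (1 / x)"
  have img: "(\<lambda>x. 1 / x) ` ?S = ?S"
  proof (intro subset_antisym subsetI)
    fix x :: real assume "x \<in> ?S"
    then show "x \<in> (\<lambda>x. 1 / x) ` ?S"
      by (intro image_eqI[of _ _ "1 / x"]) auto
  qed auto
  have "f absolutely_integrable_on UNIV"
    using int by (simp add: set_integrable_def integrable_completion borel_measurable_integrable)
  then have f: "f absolutely_integrable_on ?S"
    by (rule set_integrable_subset) auto
  have deriv: "((\<lambda>x. 1 / x) has_field_derivative - (1 / x\<^sup>2)) (at x within ?S)" if "x \<in> ?S" for x
    using that by (auto intro!: derivative_eq_intros simp: power2_eq_square)
  have "inj_on (\<lambda>x. 1 / x) ?S"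
    by (auto simp: inj_on_def)
  with deriv have "?g absolutely_integrable_on ?S \<and> integral ?S ?g = integral ?S f"
    using f by (subst has_absolute_integral_change_of_variables_1') (simp_all only: img, auto)
  then have "(?g has_integral integral ?S f) ?S" "(f has_integral integral ?S f) ?S"
    using f by (metis has_integral_iff set_lebesgue_integral_eq_integral(1))+
  then have "(\<integral>\<^sup>+x. ennreal (indicator ?S x * f x) \<partial>lborel)
      = (\<integral>\<^sup>+x. ennreal (indicator ?S x * ?g x) \<partial>lborel)"
    using nonneg by (subst (1 2) nn_integral_has_integral_lebesgue) auto
  \<comment> \<open>The point 0, where \<open>1 / x\<close> takes its default value 0, is a null
    set.\<close>
  moreover have "(\<integral>\<^sup>+x. ennreal (f x) \<partial>lborel) = (\<integral>\<^sup>+x. ennreal (indicator ?S x * f x) \<partial>lborel)"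
    "(\<integral>\<^sup>+x. ennreal (f (1 / x) / x\<^sup>2) \<partial>lborel) = (\<integral>\<^sup>+x. ennreal (indicator ?S x * ?g x) \<partial>lborel)"
    using AE_lborel_singleton[of "0::real"] by (auto intro!: nn_integral_cong_AE elim!: eventually_mono)
  ultimately show ?thesis by simp
qed

text \<open>For \<open>x \<noteq> 0\<close> the transformed density
  \<open>cauchy_density 0 b (1 / x) / x\<^sup>2\<close> is exactly
  \<open>cauchy_density 0 (1 / b) x\<close>; the two laws are compared on each Borel set.\<close>

lemma (in prob_space) distributed_cauchy_inverse:
  assumes b: "b > 0" and Y: "distributed M lborel Y (cauchy_density 0 b)"
  shows "distributed M lborel (\<lambda>\<omega>. 1 / Y \<omega>) (cauchy_density 0 (1 / b))"
proof -
  have [measurable]: "Y \<in> borel_measurable M"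
    using distributed_measurable[OF Y] by simp
  have "emeasure (distr M lborel (\<lambda>\<omega>. 1 / Y \<omega>)) A = emeasure (density lborel (cauchy_density 0 (1 / b))) A"
    if "A \<in> sets lborel" for A
  proof -
    have [measurable]: "A \<in> sets borel" using that by simp
    define f where "f = (\<lambda>x. cauchy_density 0 b x * indicator A (1 / x))"
    \<comment> \<open>Integrability moves to the probability space, where the indicator composed
      with \<open>Y\<close> is bounded by 1.\<close>
    have int: "integrable lborel f"
      unfolding f_def
      by (subst distributed_integrable[OF Y]) (use b in \<open>auto simp: cauchy_density_nonneg intro!: integrable_const_bound[where B = 1]\<close>)
    have "emeasure (distr M lborel (\<lambda>\<omega>. 1 / Y \<omega>)) A = (\<integral>\<^sup>+\<omega>. indicator A (1 / Y \<omega>) \<partial>M)"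
      by (subst nn_integral_distr[of _ M lborel, symmetric]) (auto simp: that)
    also have "\<dots> = (\<integral>\<^sup>+x. ennreal (cauchy_density 0 b x) * indicator A (1 / x) \<partial>lborel)"
      by (subst distributed_nn_integral[OF Y]) auto
    also have "\<dots> = (\<integral>\<^sup>+x. ennreal (f x) \<partial>lborel)"
      using b by (intro nn_integral_cong) (auto simp: f_def indicator_def)
    also have "\<dots> = (\<integral>\<^sup>+x. ennreal (f (1 / x) / x\<^sup>2) \<partial>lborel)"
      using b by (intro nn_integral_lborel_inverse int) (simp add: f_def cauchy_density_nonneg)
    also have "\<dots> = (\<integral>\<^sup>+x. ennreal (cauchy_density 0 (1 / b) x) * indicator A x \<partial>lborel)"
    proof (rule nn_integral_cong_AE, use AE_lborel_singleton[of "0::real"] in eventually_elim)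
      fix x :: real assume x: "x \<noteq> 0"
      have "1 + b\<^sup>2 * x\<^sup>2 > 0" by (simp add: add_pos_nonneg)
      then have "cauchy_density 0 b (1 / x) / x\<^sup>2 = cauchy_density 0 (1 / b) x"
        using x b by (simp add: cauchy_density_def power_divide divide_simps) (simp add: algebra_simps power2_eq_square)
      then show "ennreal (f (1 / x) / x\<^sup>2) = ennreal (cauchy_density 0 (1 / b) x) * indicator A x"
        by (auto simp: f_def indicator_def)
    qed
    also have "\<dots> = emeasure (density lborel (cauchy_density 0 (1 / b))) A"
      by (subst emeasure_density) auto
    finally show ?thesis .
  qed
  then have "distr M lborel (\<lambda>\<omega>. 1 / Y \<omega>) = density lborel (cauchy_density 0 (1 / b))"
    by (intro measure_eqI) auto
  then show ?thesis
    unfolding distributed_def by auto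
qed

section \<open>Continued fractions with independent entries\<close>

lemma distributed_lborel_AE_neq:
  assumes "distributed M lborel Y f"
  shows "AE \<omega> in M. Y \<omega> \<noteq> c"
proof -
  have Y: "Y \<in> measurable M lborel" and f: "f \<in> borel_measurable lborel"
    using assms by (auto simp: distributed_def)
  have "AE y in density lborel f. y \<noteq> c"
    using AE_lborel_singleton[of c] f by (subst AE_density) auto
  then show ?thesis
    using Y unfolding distributed_distr_eq_density[OF assms, symmetric]
    by (subst (asm) AE_distr_iff) auto
qed

text \<open>The space \<open>N\<close> is arbitrary so that \<open>X\<close> may also be the
  coordinate projections of a product space, as the independence argument requires.\<close>

lemma borel_measurable_cont_frac:
  assumes "xs \<noteq> []" "\<And>i. i \<in> set xs \<Longrightarrow> X i \<in> borel_measurable N"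
  shows "(\<lambda>\<omega>. cont_frac (map (\<lambda>i. X i \<omega>) xs)) \<in> borel_measurable N"
  using assms
proof (induction xs rule: induct_list012)
  case (3 i j xs)
  then show ?case by simp
qed auto

text \<open>Both claims go through one induction: the law of the tail has no atom at 0, which makes
  the longer fraction well defined. The list has \<open>k + 1\<close> entries, so it is never
  empty.\<close>

lemma (in prob_space) cont_frac_cauchy:
  assumes ind: "indep_vars (\<lambda>_. borel) X {m..}"
    and X: "\<And>i. i \<ge> m \<Longrightarrow> distributed M lborel (X i) (cauchy_density 0 1)"
  shows "(AE \<omega> in M. cont_frac_defined (map (\<lambda>i. X i \<omega>) [m..<m + Suc k])) \<and>
    distributed M lborel (\<lambda>\<omega>. cont_frac (map (\<lambda>i. X i \<omega>) [m..<m + Suc k]))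
      (cauchy_density 0 (real (fib (k + 2)) / real (fib (k + 1))))"
  using assms
proof (induction k arbitrary: m)
  case 0
  then show ?case by simp
next
  case (Suc k)
  define c where "c = real (fib (k + 2)) / real (fib (k + 1))"
  define Z where "Z = (\<lambda>\<omega>. cont_frac (map (\<lambda>i. X i \<omega>) [Suc m..<Suc m + Suc k]))"
  have fib_pos: "fib (k + 2) > 0" "fib (k + 1) > 0"
    by (simp_all add: fib_neq_0_nat)
  have c: "c > 0"
    unfolding c_def using fib_pos by simp
  have IH: "AE \<omega> in M. cont_frac_defined (map (\<lambda>i. X i \<omega>) [Suc m..<Suc m + Suc k])"
    "distributed M lborel Z (cauchy_density 0 c)"
    using Suc.IH[of "Suc m"] Suc.prems indep_vars_subset[OF Suc.prems(1), of "{Suc m..}"]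
    by (auto simp: Z_def c_def)
  have list: "map (\<lambda>i. X i \<omega>) [m..<m + Suc (Suc k)]
      = X m \<omega> # X (Suc m) \<omega> # map (\<lambda>i. X i \<omega>) [Suc (Suc m)..<Suc m + Suc k]" for \<omega>
    by (simp add: upt_conv_Cons del: upt_Suc)
  have list': "map (\<lambda>i. X i \<omega>) [Suc m..<Suc m + Suc k]
      = X (Suc m) \<omega> # map (\<lambda>i. X i \<omega>) [Suc (Suc m)..<Suc m + Suc k]" for \<omega>
    by (simp add: upt_conv_Cons del: upt_Suc)
  have "AE \<omega> in M. cont_frac_defined (map (\<lambda>i. X i \<omega>) [m..<m + Suc (Suc k)])"
    using IH(1) distributed_lborel_AE_neq[OF IH(2), of 0]
    unfolding list list' Z_def by eventually_elim simp
  moreover have "distributed M lborel (\<lambda>\<omega>. X m \<omega> + 1 / Z \<omega>) (cauchy_density 0 (1 + 1 / c))"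
  proof (rule distributed_cauchy_add)
    \<comment> \<open>Both summands are written as measurable functions of the disjoint coordinate
      blocks \<open>{m}\<close> and \<open>{Suc m..}\<close>, and so inherit independence.\<close>
    have "indep_var borel ((\<lambda>f. f m) \<circ> (\<lambda>\<omega>. restrict (\<lambda>i. X i \<omega>) {m}))
      borel ((\<lambda>f. 1 / cont_frac (map (\<lambda>i. f i) [Suc m..<Suc m + Suc k])) \<circ>
        (\<lambda>\<omega>. restrict (\<lambda>i. X i \<omega>) {Suc m..}))"
      by (intro indep_var_compose[OF indep_var_restrict[OF Suc.prems(1)]]
          borel_measurable_divide borel_measurable_const borel_measurable_cont_frac
          measurable_component_singleton) auto
    also have "(\<lambda>f. f m) \<circ> (\<lambda>\<omega>. restrict (\<lambda>i. X i \<omega>) {m}) = X m"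
      by auto
    also have "(\<lambda>f. 1 / cont_frac (map (\<lambda>i. f i) [Suc m..<Suc m + Suc k])) \<circ>
        (\<lambda>\<omega>. restrict (\<lambda>i. X i \<omega>) {Suc m..}) = (\<lambda>\<omega>. 1 / Z \<omega>)"
      by (auto simp: Z_def fun_eq_iff simp del: upt_Suc intro!: arg_cong[where f = cont_frac])
    finally show "indep_var borel (X m) borel (\<lambda>\<omega>. 1 / Z \<omega>)" .
  qed (use c IH(2) Suc.prems(2) in \<open>auto intro: distributed_cauchy_inverse\<close>)
  moreover have "(\<lambda>\<omega>. cont_frac (map (\<lambda>i. X i \<omega>) [m..<m + Suc (Suc k)])) = (\<lambda>\<omega>. X m \<omega> + 1 / Z \<omega>)"
    unfolding list list' Z_def by simp
  \<comment> \<open>The numerator of \<open>1 + 1 / c\<close> over \<open>fib (k + 2)\<close> is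
    \<open>fib (k + 2) + fib (k + 1)\<close>, the next Fibonacci number.\<close>
  moreover have "1 + 1 / c = real (fib (Suc k + 2)) / real (fib (Suc k + 1))"
    using fib_pos by (simp add: c_def field_simps)
  ultimately show ?case by simp
qed

theorem theorem4p2:
  fixes M :: "'a measure" and X :: "nat \<Rightarrow> 'a \<Rightarrow> real" and n :: nat
  assumes "prob_space M"
    and "prob_space.indep_vars M (\<lambda>_. borel) X {1..}"
    and "\<And>i. i \<ge> 1 \<Longrightarrow> distributed M lborel (X i) (cauchy_density 0 1)"
    and "n \<ge> 1"
  shows "(AE \<omega> in M. cont_frac_defined (map (\<lambda>i. X i \<omega>) [1..<Suc n])) \<and>
         distributed M lborel (\<lambda>\<omega>. cont_frac (map (\<lambda>i. X i \<omega>) [1..<Suc n]))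
           (cauchy_density 0 (real (fib (n + 1)) / real (fib n)))"
proof -
  interpret prob_space M by fact
  \<comment> \<open>A fraction with \<open>n\<close> entries is the case \<open>k = n - 1\<close>,
    \<open>m = 1\<close>.\<close>
  have "1 + Suc (n - 1) = Suc n" "n - 1 + 2 = n + 1" "n - 1 + 1 = n"
    using assms(4) by auto
  then show ?thesis
    using cont_frac_cauchy[OF assms(2,3), of "n - 1"] by metis
qed

end
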